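(* Let $A$ be a commutative ring with unit containing $\mathbb{Q}$ and $\mathcal{A}=1+XA[[X]]$. Let $f,g\in\mathcal{A}$ and write, using the isomorphism given by the exponential map, $f=e^F=e^{F_1X+F_2X^2+F_3X^3+\cdots}$ and $g=e^G=e^{G_1X+G_2X^2+G_3X^3+\cdots}$ with $F,G\in XA[[X]]$. Then $$f\star g=\exp\left(-F_1G_1X-2F_2G_2X^2-3F_3G_3X^3-\cdots\right)=\exp\left(-\sum_{i\ge1}i\,F_iG_i\,X^i\right).$$
   Context: The exponential $\exp(F)=e^F=\sum_{n\ge0}F^n/n!$ is a group isomorphism $(XA[[X]],+)\to(\mathcal{A},\cdot)$. Eñe product: for $n\ge1$, let $Q_n\in\mathbb{Z}[X_1,\dots,X_n,Y_1,\dots,Y_n]$ be the unique polynomial such that in $\mathbb{Z}[x_1,\dots,x_n,y_1,\dots,y_n]$ the $n$-th elementary symmetric polynomial of the $n^2$ products $x_iy_j$ equals $Q_n(e_1(x),\dots,e_n(x),e_1(y),\dots,e_n(y))$, where $e_k$ are the elementary symmetric polynomials. For $f=1+\sum_{n\ge1}a_nX^n$ and $g=1+\sum_{n\ge1}b_nX^n$ in $\mathcal{A}$, $f\star g=1+\sum_{n\ge1}c_nX^n$ with $c_n=(-1)^nQ_n(a_1,\dots,a_n,b_1,\dots,b_n)$. *)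

theory Defs
  imports
    "HOL-Computational_Algebra.Formal_Power_Series"
    "HOL-Library.Poly_Mapping"
    "Jordan_Normal_Form.Matrix"
begin

text \<open>
  Polynomials with integer coefficients in variables from \<open>'v\<close>, as finitely supported maps from
  exponent vectors to coefficients; the library makes this type a commutative ring.
\<close>
type_synonym 'v zpoly = "('v \<Rightarrow>\<^sub>0 nat) \<Rightarrow>\<^sub>0 int"

definition zvar :: "'v \<Rightarrow> 'v zpoly" where
  "zvar v = Poly_Mapping.single (Poly_Mapping.single v 1) 1"

definition zpoly_vars :: "'v zpoly \<Rightarrow> 'v set" where
  "zpoly_vars p = (\<Union>m\<in>Poly_Mapping.keys p. Poly_Mapping.keys m)"

definition zpoly_eval :: "('v \<Rightarrow> 'a::comm_ring_1) \<Rightarrow> 'v zpoly \<Rightarrow> 'a" where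
  "zpoly_eval \<sigma> p =
     (\<Sum>m\<in>Poly_Mapping.keys p. of_int (Poly_Mapping.lookup p m) *
        (\<Prod>v\<in>Poly_Mapping.keys m. \<sigma> v ^ Poly_Mapping.lookup m v))"

text \<open>The \<open>k\<close>-th elementary symmetric polynomial of the finite family \<open>t i\<close>, \<open>i \<in> I\<close>.\<close>
definition elem_sym :: "'i set \<Rightarrow> ('i \<Rightarrow> 'a::comm_ring_1) \<Rightarrow> nat \<Rightarrow> 'a" where
  "elem_sym I t k = (\<Sum>S | S \<subseteq> I \<and> card S = k. \<Prod>i\<in>S. t i)"

text \<open>
  The two blocks of variables are told apart by the sum type: \<open>Inl i\<close> stands for
  \<open>X\<^sub>i\<close> (or \<open>x\<^sub>i\<close>) and \<open>Inr i\<close> for \<open>Y\<^sub>i\<close> (or \<open>y\<^sub>i\<close>).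
\<close>
definition ene_Q :: "nat \<Rightarrow> (nat + nat) zpoly" where
  "ene_Q n = (THE q.
     zpoly_vars q \<subseteq> Inl ` {1..n} \<union> Inr ` {1..n} \<and>
     elem_sym ({1..n} \<times> {1..n}) (\<lambda>(i, j). zvar (Inl i) * zvar (Inr j) :: (nat + nat) zpoly) n =
     zpoly_eval
       (case_sum (elem_sym {1..n} (\<lambda>i. zvar (Inl i))) (elem_sym {1..n} (\<lambda>j. zvar (Inr j)))) q)"

text \<open>Meaningful for series with constant coefficient 1.\<close>
definition ene_prod :: "'a::comm_ring_1 fps \<Rightarrow> 'a fps \<Rightarrow> 'a fps" (infixl \<open>\<star>\<close> 70) where
  "f \<star> g = Abs_fps (\<lambda>n. if n = 0 then 1
     else (- 1) ^ n * zpoly_eval (case_sum (fps_nth f) (fps_nth g)) (ene_Q n))"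

text \<open>
  The embedding \<open>\<iota>\<close> of the rationals into \<open>'a\<close> supplies the coefficients \<open>1 / n!\<close>. The infinite sum
  is taken in the \<open>X\<close>-adic topology of \<open>'a fps\<close>; it converges if \<open>F\<close> has no constant term.
  (The library's \<open>fps_exp c\<close> is only the special case of the exponential of \<open>c X\<close> over a field.)
\<close>
definition fps_Exp :: "(rat \<Rightarrow> 'a) \<Rightarrow> 'a::comm_ring_1 fps \<Rightarrow> 'a fps" where
  "fps_Exp \<iota> F = suminf (\<lambda>n. fps_const (\<iota> (1 / fact n)) * F ^ n)"

end

theory Submission
  imports Defs "HOL-Computational_Algebra.Polynomial"
begin

text \<open>
  For \<open>f = \<Prod>(1 + x\<^sub>i X)\<close> and \<open>g = \<Prod>(1 + y\<^sub>j X)\<close> one has \<open>f \<star> g = \<Prod>(1 - x\<^sub>i y\<^sub>j X)\<close>, and the coefficients of the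
  logarithmic derivatives are signed power sums, so those of \<open>f \<star> g\<close> are minus the products of those of
  \<open>f\<close> and \<open>g\<close>. By Newton's identities this makes \<open>(-1)\<^sup>n n! Q\<^sub>n\<close> an explicit integer polynomial \<open>P\<^sub>n\<close>,
  whose recursion also computes \<open>n!\<close> times the coefficients of the exponential on the right-hand side.

  To see that \<open>P\<^sub>n\<close> is divisible by \<open>n!\<close>, and that \<open>Q\<^sub>n\<close> is unique, the algebraic independence of the elementary
  symmetric polynomials is needed modulo every integer \<open>c\<close>: if \<open>c\<close> divides \<open>q(e(x), e(y))\<close>, then \<open>c\<close>
  divides \<open>q\<close>. The case \<open>c = n!\<close> gives existence and the case \<open>c = 0\<close> uniqueness.
\<close>

section \<open>Evaluation of integer polynomials\<close>

definition monom_eval :: "('v \<Rightarrow> 'a::comm_ring_1) \<Rightarrow> ('v \<Rightarrow>\<^sub>0 nat) \<Rightarrow> 'a" where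
  "monom_eval \<sigma> m = (\<Prod>v\<in>Poly_Mapping.keys m. \<sigma> v ^ Poly_Mapping.lookup m v)"

lemma monom_eval_superset:
  assumes "finite V" "Poly_Mapping.keys m \<subseteq> V"
  shows "monom_eval \<sigma> m = (\<Prod>v\<in>V. \<sigma> v ^ Poly_Mapping.lookup m v)"
  unfolding monom_eval_def
  by (rule prod.mono_neutral_left) (use assms in \<open>auto simp: in_keys_iff\<close>)

lemma monom_eval_0 [simp]: "monom_eval \<sigma> 0 = 1"
  by (simp add: monom_eval_def)

lemma monom_eval_add: "monom_eval \<sigma> (m + n) = monom_eval \<sigma> m * monom_eval \<sigma> n"
proof -
  let ?V = "Poly_Mapping.keys m \<union> Poly_Mapping.keys n"
  have "Poly_Mapping.keys (m + n) \<subseteq> ?V"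
    by (rule Poly_Mapping.keys_add)
  then show ?thesis
    by (simp add: monom_eval_superset[of ?V] lookup_add power_add prod.distrib)
qed

lemma zpoly_eval_superset:
  assumes "finite K" "Poly_Mapping.keys p \<subseteq> K"
  shows "zpoly_eval \<sigma> p = (\<Sum>m\<in>K. of_int (Poly_Mapping.lookup p m) * monom_eval \<sigma> m)"
  unfolding zpoly_eval_def monom_eval_def
  by (rule sum.mono_neutral_left) (use assms in \<open>auto simp: in_keys_iff\<close>)

lemma zpoly_eval_add: "zpoly_eval \<sigma> (p + q) = zpoly_eval \<sigma> p + zpoly_eval \<sigma> q"
proof -
  let ?K = "Poly_Mapping.keys p \<union> Poly_Mapping.keys q"
  have "Poly_Mapping.keys (p + q) \<subseteq> ?K"
    by (rule Poly_Mapping.keys_add)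
  then show ?thesis
    by (simp add: zpoly_eval_superset[of ?K] lookup_add ring_distribs sum.distrib)
qed

lemma zpoly_eval_single: "zpoly_eval \<sigma> (Poly_Mapping.single m c) = of_int c * monom_eval \<sigma> m"
  by (simp add: zpoly_eval_superset[of "{m}"])

lemma zpoly_eval_0 [simp]: "zpoly_eval \<sigma> 0 = 0"
  by (simp add: zpoly_eval_def)

lemma zpoly_eval_sum: "zpoly_eval \<sigma> (\<Sum>i\<in>I. p i) = (\<Sum>i\<in>I. zpoly_eval \<sigma> (p i))"
  by (induction I rule: infinite_finite_induct) (auto simp: zpoly_eval_add)

lemma zpoly_sum_monomials:
  "p = (\<Sum>m\<in>Poly_Mapping.keys p. Poly_Mapping.single m (Poly_Mapping.lookup p m))"
  by (rule poly_mapping_eqI) (auto simp: lookup_sum lookup_single when_def in_keys_iff)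

text \<open>Both factors are expanded into monomials; a product of monomials adds exponent vectors,
  and \<open>monom_eval\<close> turns that addition into multiplication.\<close>

lemma zpoly_eval_mult: "zpoly_eval \<sigma> (p * q) = zpoly_eval \<sigma> p * zpoly_eval \<sigma> q"
proof -
  let ?P = "Poly_Mapping.keys p" and ?Q = "Poly_Mapping.keys q"
  have "p * q = (\<Sum>m\<in>?P. \<Sum>n\<in>?Q.
      Poly_Mapping.single (m + n) (Poly_Mapping.lookup p m * Poly_Mapping.lookup q n))"
    using arg_cong2[OF zpoly_sum_monomials[of p] zpoly_sum_monomials[of q], of "(*)"]
    by (simp only: sum_product mult_single)
  then have "zpoly_eval \<sigma> (p * q) = (\<Sum>m\<in>?P. \<Sum>n\<in>?Q.
      (of_int (Poly_Mapping.lookup p m) * monom_eval \<sigma> m) *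
      (of_int (Poly_Mapping.lookup q n) * monom_eval \<sigma> n))"
    by (simp add: zpoly_eval_sum zpoly_eval_single monom_eval_add mult_ac)
  then show ?thesis
    by (simp add: sum_product zpoly_eval_superset[of ?P p] zpoly_eval_superset[of ?Q q])
qed

lemma of_int_zpoly: "(of_int c :: 'v zpoly) = Poly_Mapping.single 0 c"
  by (metis single_of_int of_int_eq_id id_apply)

lemma zpoly_eval_of_int [simp]: "zpoly_eval \<sigma> (of_int c) = of_int c"
  by (simp add: of_int_zpoly zpoly_eval_single)

lemma zpoly_eval_of_nat [simp]: "zpoly_eval \<sigma> (of_nat n) = of_nat n"
  using zpoly_eval_of_int[of \<sigma> "int n"] by simp

lemma zpoly_eval_1 [simp]: "zpoly_eval \<sigma> 1 = 1"
  using zpoly_eval_of_int[of \<sigma> 1] by simp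

lemma zpoly_eval_uminus: "zpoly_eval \<sigma> (- p) = - zpoly_eval \<sigma> p"
  using zpoly_eval_add[of \<sigma> p "- p"] by (simp add: eq_neg_iff_add_eq_0 add.commute)

lemma zpoly_eval_diff: "zpoly_eval \<sigma> (p - q) = zpoly_eval \<sigma> p - zpoly_eval \<sigma> q"
  using zpoly_eval_add[of \<sigma> p "- q"] by (simp add: zpoly_eval_uminus)

lemma zpoly_eval_prod: "zpoly_eval \<sigma> (\<Prod>i\<in>I. p i) = (\<Prod>i\<in>I. zpoly_eval \<sigma> (p i))"
  by (induction I rule: infinite_finite_induct) (auto simp: zpoly_eval_mult)

lemma zpoly_eval_power: "zpoly_eval \<sigma> (p ^ k) = zpoly_eval \<sigma> p ^ k"
  by (induction k) (auto simp: zpoly_eval_mult)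

lemma zpoly_eval_zvar [simp]: "zpoly_eval \<sigma> (zvar v) = \<sigma> v"
  by (simp add: zvar_def zpoly_eval_single monom_eval_superset[of "{v}"])

lemma zpoly_eval_monom_eval:
  "zpoly_eval \<tau> (monom_eval \<sigma> m) = monom_eval (\<lambda>v. zpoly_eval \<tau> (\<sigma> v)) m"
  by (simp add: monom_eval_def zpoly_eval_prod zpoly_eval_power)

text \<open>Successive substitutions compose. This allows an identity between polynomials in the
  elementary symmetric polynomials to be specialised further to powers of one variable.\<close>

lemma zpoly_eval_zpoly_eval:
  "zpoly_eval \<tau> (zpoly_eval \<sigma> p) = zpoly_eval (\<lambda>v. zpoly_eval \<tau> (\<sigma> v)) p"
  by (simp add: zpoly_eval_superset[of "Poly_Mapping.keys p" p] zpoly_eval_sum zpoly_eval_mult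
      zpoly_eval_monom_eval)

lemma zpoly_eval_elem_sym:
  "zpoly_eval \<tau> (elem_sym I t k) = elem_sym I (\<lambda>i. zpoly_eval \<tau> (t i)) k"
  by (simp add: elem_sym_def zpoly_eval_sum zpoly_eval_prod)

section \<open>Multiplication and exact division by integers\<close>

lemma lookup_of_int_mult: "Poly_Mapping.lookup (of_int c * p :: 'v zpoly) m = c * Poly_Mapping.lookup p m"
proof -
  have "of_int c * p = Poly_Mapping.map ((*) c) p"
    unfolding mult_map_scale_conv_mult of_int_zpoly ..
  then show ?thesis
    by (simp add: map.rep_eq when_def)
qed

lemma of_int_mult_cancel_zpoly:
  assumes "of_int c * p = of_int c * (q :: 'v zpoly)" "c \<noteq> 0"
  shows "p = q"
proof (rule poly_mapping_eqI)
  fix m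
  from arg_cong[OF assms(1), of "\<lambda>r. Poly_Mapping.lookup r m"] assms(2)
  show "Poly_Mapping.lookup p m = Poly_Mapping.lookup q m"
    by (simp add: lookup_of_int_mult)
qed

text \<open>The inclusion of keys is recorded so that the quotient involves no variables beyond
  those of \<open>p\<close>.\<close>

lemma ex_zpoly_quotient:
  assumes "\<And>m. c dvd Poly_Mapping.lookup (p :: 'v zpoly) m"
  obtains q where "p = of_int c * q" "Poly_Mapping.keys q \<subseteq> Poly_Mapping.keys p"
proof
  let ?q = "Poly_Mapping.map (\<lambda>x. x div c) p"
  show "p = of_int c * ?q"
    by (rule poly_mapping_eqI)
       (use assms in \<open>auto simp: lookup_of_int_mult map.rep_eq when_def\<close>)
  show "Poly_Mapping.keys ?q \<subseteq> Poly_Mapping.keys p"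
    by (auto simp: in_keys_iff map.rep_eq when_def)
qed

section \<open>Bounds on the variables of a polynomial\<close>

lemma zpoly_vars_add:
  assumes "zpoly_vars p \<subseteq> V" "zpoly_vars q \<subseteq> V" shows "zpoly_vars (p + q) \<subseteq> V"
  using assms Poly_Mapping.keys_add[of p q] unfolding zpoly_vars_def by blast

lemma zpoly_vars_mult:
  assumes "zpoly_vars p \<subseteq> V" "zpoly_vars q \<subseteq> V" shows "zpoly_vars (p * q) \<subseteq> V"
proof
  fix v assume "v \<in> zpoly_vars (p * q)"
  then obtain m where m: "m \<in> Poly_Mapping.keys (p * q)" "v \<in> Poly_Mapping.keys m"
    by (auto simp: zpoly_vars_def)
  with keys_mult[of p q] obtain a b where
    "a \<in> Poly_Mapping.keys p" "b \<in> Poly_Mapping.keys q" "m = a + b"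
    by blast
  with m Poly_Mapping.keys_add[of a b] assms show "v \<in> V"
    unfolding zpoly_vars_def by blast
qed

lemma zpoly_vars_of_int: "zpoly_vars (of_int c) = {}"
  by (simp add: zpoly_vars_def of_int_zpoly)

lemma zpoly_vars_zvar: "zpoly_vars (zvar v) = {v}"
  by (simp add: zpoly_vars_def zvar_def)

lemma zpoly_vars_of_int_mult: "zpoly_vars p \<subseteq> V \<Longrightarrow> zpoly_vars (of_int c * p) \<subseteq> V"
  by (rule zpoly_vars_mult) (simp_all add: zpoly_vars_of_int)

lemma zpoly_vars_of_nat_mult: "zpoly_vars p \<subseteq> V \<Longrightarrow> zpoly_vars (of_nat c * p) \<subseteq> V"
  using zpoly_vars_of_int_mult[of p V "int c"] by simp

lemma zpoly_vars_uminus: "zpoly_vars p \<subseteq> V \<Longrightarrow> zpoly_vars (- p) \<subseteq> V"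
  using zpoly_vars_of_int_mult[of p V "- 1"] by simp

lemma zpoly_vars_diff:
  assumes "zpoly_vars p \<subseteq> V" "zpoly_vars q \<subseteq> V" shows "zpoly_vars (p - q) \<subseteq> V"
  using zpoly_vars_add[OF assms(1) zpoly_vars_uminus[OF assms(2)]] by simp

lemma zpoly_vars_sum:
  "(\<And>i. i \<in> I \<Longrightarrow> zpoly_vars (p i) \<subseteq> V) \<Longrightarrow> zpoly_vars (\<Sum>i\<in>I. p i) \<subseteq> V"
proof (induction I rule: infinite_finite_induct)
  case (insert i I)
  then show ?case by (simp add: zpoly_vars_add)
qed (simp_all add: zpoly_vars_def)

section \<open>Logarithmic derivatives and Newton's identities\<close>

text \<open>
  The coefficients \<open>l\<close> of \<open>a' / a\<close> for a power series with coefficients \<open>a\<close>, where \<open>a 0\<close> is never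
  read and is taken to be 1.
\<close>
fun log_deriv :: "(nat \<Rightarrow> 'a::comm_ring_1) \<Rightarrow> nat \<Rightarrow> 'a" where
  "log_deriv a k = of_nat (Suc k) * a (Suc k) - (\<Sum>i\<in>{1..k}. a i * log_deriv a (k - i))"

declare log_deriv.simps [simp del]

text \<open>
  The coefficients \<open>b\<close> of the solution of \<open>b' = l b\<close>, \<open>b 0 = 1\<close>, scaled to \<open>n! b n\<close> so that no
  division is needed.
\<close>
fun scaled_exp :: "(nat \<Rightarrow> 'a::comm_ring_1) \<Rightarrow> nat \<Rightarrow> 'a" where
  "scaled_exp l 0 = 1"
| "scaled_exp l (Suc n) = (\<Sum>i\<in>{..n}. of_nat (fact n div fact i) * scaled_exp l i * l (n - i))"

text \<open>The second assumption is a' = a l, read off coefficientwise. As \<open>a 0 = 1\<close>,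
  the term with \<open>i = 0\<close> is \<open>l k\<close> itself, so the equation can be solved for
  it without division.\<close>

lemma log_deriv_unique:
  assumes "a 0 = 1" and "\<And>k. of_nat (Suc k) * a (Suc k) = (\<Sum>i=0..k. a i * l (k - i))"
  shows "log_deriv a k = l k"
proof (induction k rule: less_induct)
  case (less k)
  have "(\<Sum>i\<in>{1..k}. a i * log_deriv a (k - i)) = (\<Sum>i\<in>{1..k}. a i * l (k - i))"
    by (intro sum.cong refl) (use less in auto)
  moreover have "(\<Sum>i=0..k. a i * l (k - i)) = l k + (\<Sum>i\<in>{1..k}. a i * l (k - i))"
    by (simp add: sum.atLeast_Suc_atMost assms(1))
  ultimately show ?case
    by (simp only: log_deriv.simps[of a k] assms(2)) simp
qed

text \<open>The second assumption is b' = b l. Multiplied by k!, its terms acquire k! = (k!/i!) i!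
  with an exact integer quotient, which is the recursion of \<open>scaled_exp\<close>.\<close>

lemma scaled_exp_unique:
  assumes "b 0 = 1" and "\<And>n. of_nat (Suc n) * b (Suc n) = (\<Sum>i=0..n. b i * l (n - i))"
  shows "scaled_exp l n = of_nat (fact n) * b n"
proof (induction n rule: less_induct)
  case (less n)
  show ?case
  proof (cases n)
    case 0
    then show ?thesis by (simp add: assms(1))
  next
    case (Suc k)
    have "scaled_exp l n = (\<Sum>i\<in>{..k}. of_nat (fact k div fact i) * (of_nat (fact i) * b i) * l (k - i))"
      unfolding Suc scaled_exp.simps
      by (intro sum.cong refl) (use less Suc in auto)
    also have "\<dots> = (\<Sum>i\<in>{..k}. of_nat (fact k) * (b i * l (k - i)))"
    proof (intro sum.cong refl)
      fix i assume "i \<in> {..k}"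
      then have "fact k div fact i * fact i = (fact k :: nat)"
        by (simp add: fact_dvd)
      then have "of_nat (fact k div fact i) * of_nat (fact i) = (of_nat (fact k) :: 'a)"
        by (metis of_nat_mult)
      then show "of_nat (fact k div fact i) * (of_nat (fact i) * b i) * l (k - i)
          = of_nat (fact k) * (b i * l (k - i))"
        by (metis mult.assoc)
    qed
    also have "\<dots> = of_nat (fact k) * (of_nat (Suc k) * b (Suc k))"
      by (simp only: assms(2) sum_distrib_left atLeast0AtMost)
    also have "\<dots> = of_nat (fact n) * b n"
      by (simp add: Suc fact_Suc algebra_simps)
    finally show ?thesis .
  qed
qed

text \<open>The recursion uses only ring operations and integer constants, so it commutes with every
  substitution; the same holds for \<open>scaled_exp\<close> below.\<close>

lemma zpoly_eval_log_deriv: "zpoly_eval \<sigma> (log_deriv a k) = log_deriv (\<lambda>i. zpoly_eval \<sigma> (a i)) k"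
proof (induction k rule: less_induct)
  case (less k)
  have "(\<Sum>i\<in>{1..k}. zpoly_eval \<sigma> (a i) * zpoly_eval \<sigma> (log_deriv a (k - i)))
      = (\<Sum>i\<in>{1..k}. zpoly_eval \<sigma> (a i) * log_deriv (\<lambda>i. zpoly_eval \<sigma> (a i)) (k - i))"
    by (intro sum.cong refl) (use less in auto)
  then show ?case
    by (simp only: log_deriv.simps[of _ k] zpoly_eval_diff zpoly_eval_mult zpoly_eval_sum
        zpoly_eval_of_nat)
qed

lemma zpoly_eval_scaled_exp:
  "zpoly_eval \<sigma> (scaled_exp l n) = scaled_exp (\<lambda>i. zpoly_eval \<sigma> (l i)) n"
proof (induction n rule: less_induct)
  case (less n)
  show ?case
  proof (cases n)
    case (Suc k)
    have "(\<Sum>i\<in>{..k}. of_nat (fact k div fact i) * zpoly_eval \<sigma> (scaled_exp l i) * zpoly_eval \<sigma> (l (k - i)))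
        = (\<Sum>i\<in>{..k}. of_nat (fact k div fact i) * scaled_exp (\<lambda>i. zpoly_eval \<sigma> (l i)) i
             * zpoly_eval \<sigma> (l (k - i)))"
      by (intro sum.cong refl) (use less Suc in auto)
    then show ?thesis
      by (simp only: Suc scaled_exp.simps zpoly_eval_mult zpoly_eval_sum zpoly_eval_of_nat)
  qed simp
qed

text \<open>Together with the next lemma this confines P_n to the variables with indices 1 to n, as
  the definition of \<open>ene_Q\<close> demands.\<close>

lemma zpoly_vars_log_deriv:
  assumes "\<And>i. i \<in> {1..Suc k} \<Longrightarrow> zpoly_vars (a i) \<subseteq> V"
  shows "zpoly_vars (log_deriv a k) \<subseteq> V"
  using assms
proof (induction k rule: less_induct)
  case (less k)
  show ?case
    unfolding log_deriv.simps[of a k]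
    by (intro zpoly_vars_diff zpoly_vars_of_nat_mult zpoly_vars_sum zpoly_vars_mult less) auto
qed

lemma zpoly_vars_scaled_exp:
  assumes "\<And>i. i < n \<Longrightarrow> zpoly_vars (l i) \<subseteq> V"
  shows "zpoly_vars (scaled_exp l n) \<subseteq> V"
  using assms
proof (induction n rule: less_induct)
  case (less n)
  show ?case
  proof (cases n)
    case 0
    then show ?thesis by (metis scaled_exp.simps(1) zpoly_vars_of_int of_int_1 empty_subsetI)
  next
    case (Suc k)
    show ?thesis
      unfolding Suc scaled_exp.simps
      by (intro zpoly_vars_of_nat_mult zpoly_vars_sum zpoly_vars_mult less) (auto simp: Suc)
  qed
qed

section \<open>Generating functions of elementary symmetric polynomials\<close>

lemma elem_sym_0:
  assumes "finite I" shows "elem_sym I t 0 = 1"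
proof -
  have "{S. S \<subseteq> I \<and> card S = 0} = {{}}"
    using assms by (auto simp: card_eq_0_iff dest: finite_subset)
  then show ?thesis by (simp add: elem_sym_def)
qed

lemma prod_fps_const: "(\<Prod>i\<in>I. fps_const (t i)) = fps_const (\<Prod>i\<in>I. t i)"
  by (induction I rule: infinite_finite_induct) auto

lemma fps_nth_prod_linear:
  assumes "finite I"
  shows "fps_nth (\<Prod>i\<in>I. fps_const (t i) * fps_X + 1) k = elem_sym I t k"
proof -
  have "(\<Prod>i\<in>I. fps_const (t i) * fps_X + 1) = (\<Sum>S\<in>Pow I. fps_const (\<Prod>i\<in>S. t i) * fps_X ^ card S)"
    by (simp add: prod_add[OF assms] prod.distrib prod_fps_const)
  then have "fps_nth (\<Prod>i\<in>I. fps_const (t i) * fps_X + 1) k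
      = (\<Sum>S\<in>Pow I. if k = card S then \<Prod>i\<in>S. t i else 0)"
    by (simp add: fps_sum_nth if_distrib cong: if_cong)
  also have "\<dots> = (\<Sum>S\<in>{S\<in>Pow I. k = card S}. \<Prod>i\<in>S. t i)"
    using assms by (intro sum.inter_filter[symmetric]) auto
  also have "{S\<in>Pow I. k = card S} = {S. S \<subseteq> I \<and> card S = k}"
    by auto
  finally show ?thesis by (simp add: elem_sym_def)
qed

text \<open>Logarithmic derivatives of the factors add up, and that of 1 + t X is t / (1 + t X), the
  geometric series with coefficients (-1)^k t^(k+1).\<close>

lemma fps_deriv_prod_linear:
  fixes t :: "'i \<Rightarrow> 'a::comm_ring_1"
  assumes "finite I"
  shows "fps_deriv (\<Prod>i\<in>I. fps_const (t i) * fps_X + 1)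
    = (\<Prod>i\<in>I. fps_const (t i) * fps_X + 1) * Abs_fps (\<lambda>k. \<Sum>i\<in>I. (- 1) ^ k * t i ^ Suc k)"
  using assms
proof (induction I rule: finite_induct)
  case empty
  then show ?case by (simp add: fps_eq_iff)
next
  case (insert j I)
  let ?p = "fps_const (t j) * fps_X + 1" and ?P = "\<Prod>i\<in>I. fps_const (t i) * fps_X + 1"
  let ?l = "Abs_fps (\<lambda>k. (- 1) ^ k * t j ^ Suc k)" and ?L = "Abs_fps (\<lambda>k. \<Sum>i\<in>I. (- 1) ^ k * t i ^ Suc k)"
  have geom: "?p * ?l = fps_const (t j)"
  proof (rule fps_ext)
    fix n
    show "fps_nth (?p * ?l) n = fps_nth (fps_const (t j)) n"
      by (cases n) (simp_all add: ring_distribs mult_ac)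
  qed
  have "fps_deriv (?p * ?P) = ?p * (?P * ?L) + fps_const (t j) * ?P"
    by (simp add: insert.IH)
  also have "\<dots> = ?p * ?P * (?l + ?L)"
    by (subst geom[symmetric]) (simp add: algebra_simps)
  also have "?l + ?L = Abs_fps (\<lambda>k. \<Sum>i\<in>insert j I. (- 1) ^ k * t i ^ Suc k)"
    using insert.hyps by (simp add: fps_eq_iff)
  finally show ?case using insert.hyps by simp
qed

lemma newton_identity:
  assumes "finite I"
  shows "of_nat (Suc n) * elem_sym I t (Suc n)
    = (\<Sum>i=0..n. elem_sym I t i * (\<Sum>j\<in>I. (- 1) ^ (n - i) * t j ^ Suc (n - i)))"
  using arg_cong[OF fps_deriv_prod_linear[OF assms, of t], of "\<lambda>f. fps_nth f n"]
  by (simp add: fps_mult_nth fps_nth_prod_linear[OF assms] del: of_nat_Suc power_Suc)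

lemma log_deriv_elem_sym:
  assumes "finite I"
  shows "log_deriv (elem_sym I t) k = (\<Sum>j\<in>I. (- 1) ^ k * t j ^ Suc k)"
  by (rule log_deriv_unique) (simp_all only: elem_sym_0[OF assms] newton_identity[OF assms])

lemma scaled_exp_elem_sym:
  assumes "finite I"
  shows "scaled_exp (\<lambda>k. \<Sum>j\<in>I. (- 1) ^ k * t j ^ Suc k) n = of_nat (fact n) * elem_sym I t n"
  by (rule scaled_exp_unique) (simp_all only: elem_sym_0[OF assms] newton_identity[OF assms])

lemma elem_sym_uminus: "elem_sym I (\<lambda>i. - t i) k = (- 1) ^ k * elem_sym I t k"
  unfolding elem_sym_def by (auto simp: prod_uminus sum_distrib_left intro!: sum.cong)

text \<open>A product of two power sums is the power sum of all x_i y_j. The two signs (-1)^k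
  cancel, and -z^(k+1) = (-1)^k (-z)^(k+1) shows that the result is the sequence belonging to the
  family of all -x_i y_j.\<close>

lemma scaled_exp_products:
  fixes x y :: "nat \<Rightarrow> 'a::comm_ring_1"
  assumes "finite I" "finite J"
  shows "scaled_exp (\<lambda>k. - (log_deriv (elem_sym I x) k * log_deriv (elem_sym J y) k)) n
    = (- 1) ^ n * of_nat (fact n) * elem_sym (I \<times> J) (\<lambda>(i, j). x i * y j) n"
proof -
  have "- (log_deriv (elem_sym I x) k * log_deriv (elem_sym J y) k)
      = (\<Sum>p\<in>I \<times> J. (- 1) ^ k * (- (case p of (i, j) \<Rightarrow> x i * y j)) ^ Suc k)" for k
  proof -
    have "- (((- 1) ^ k * x i ^ Suc k) * ((- 1) ^ k * y j ^ Suc k))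
        = (- 1) ^ k * (- (x i * y j)) ^ Suc k" for i j
      by (simp only: power_minus[of "x i * y j"] power_mult_distrib) (simp add: mult_ac)
    then show ?thesis
      by (simp only: log_deriv_elem_sym assms sum_product sum_negf[symmetric] sum.cartesian_product)
         (intro sum.cong refl, auto)
  qed
  then have "scaled_exp (\<lambda>k. - (log_deriv (elem_sym I x) k * log_deriv (elem_sym J y) k)) n
      = of_nat (fact n) * elem_sym (I \<times> J) (\<lambda>p. - (case p of (i, j) \<Rightarrow> x i * y j)) n"
    by (simp only: scaled_exp_elem_sym[OF finite_cartesian_product[OF assms]])
  then show ?thesis
    by (simp add: elem_sym_uminus mult_ac)
qed

section \<open>Algebraic independence of the elementary symmetric polynomials\<close>

text \<open>The residue modulo \<open>M\<close> is the lowest digit; the remaining digits follow by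
  induction on the quotients.\<close>

lemma digits_unique:
  fixes a b :: "nat \<Rightarrow> nat"
  assumes "\<And>i. i < N \<Longrightarrow> a i < M" "\<And>i. i < N \<Longrightarrow> b i < M"
    and "(\<Sum>i<N. M ^ i * a i) = (\<Sum>i<N. M ^ i * b i)" and "i < N"
  shows "a i = b i"
  using assms
proof (induction N arbitrary: a b i)
  case (Suc N)
  have split: "(\<Sum>i<Suc N. M ^ i * c i) = c 0 + M * (\<Sum>i<N. M ^ i * c (Suc i))" for c :: "nat \<Rightarrow> nat"
    by (simp only: sum.lessThan_Suc_shift sum_distrib_left) (simp add: mult_ac)
  have lt: "a 0 < M" "b 0 < M" using Suc.prems by auto
  have eq: "a 0 + M * (\<Sum>i<N. M ^ i * a (Suc i)) = b 0 + M * (\<Sum>i<N. M ^ i * b (Suc i))"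
    using Suc.prems(3) unfolding split .
  from arg_cong[OF eq, of "\<lambda>n. n mod M"] lt have 0: "a 0 = b 0"
    by simp
  with eq lt have "(\<Sum>i<N. M ^ i * a (Suc i)) = (\<Sum>i<N. M ^ i * b (Suc i))"
    by simp
  with Suc.IH[of "\<lambda>i. a (Suc i)" "\<lambda>i. b (Suc i)" "i - 1"] Suc.prems 0 show ?case
    by (cases i) auto
qed simp

text \<open>\<open>S - {1..k}\<close> and \<open>{1..k} - S\<close> have equally many elements. The
  weights are at most \<open>w (Suc k)\<close> on the former and at least \<open>w k\<close> on the
  latter.\<close>

lemma sum_initial_segment_less:
  fixes w :: "nat \<Rightarrow> nat"
  assumes w: "\<And>i j. i \<in> {1..n} \<Longrightarrow> j \<in> {1..n} \<Longrightarrow> i < j \<Longrightarrow> w j < w i"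
    and S: "S \<subseteq> {1..n}" "card S = k" "S \<noteq> {1..k}"
  shows "sum w S < sum w {1..k}"
proof -
  have fin: "finite S" using S finite_subset by blast
  have kn: "k \<le> n" using S card_mono[of "{1..n}" S] by simp
  let ?A = "S - {1..k}" and ?B = "{1..k} - S"
  have "card ?A + card (S \<inter> {1..k}) = card S" "card ?B + card (S \<inter> {1..k}) = card {1..k}"
    using fin card_Int_Diff[of S "{1..k}"] card_Int_Diff[of "{1..k}" S] by (simp_all add: Int_commute)
  then have card: "card ?A = card ?B" using S by simp
  have "card ?A \<noteq> 0"
  proof
    assume "card ?A = 0"
    then have "S \<subseteq> {1..k}" using fin by auto
    then show False using S card_subset_eq[of "{1..k}" S] by simp
  qed
  then have B: "?B \<noteq> {}" and A: "?A \<noteq> {}" using card by (metis card.empty)+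
  then obtain a where "a \<in> ?A" by blast
  then have k1: "Suc k \<in> {1..n}" using S by auto
  have k0: "k \<in> {1..n}" using B kn by auto
  have "sum w ?A \<le> card ?A * w (Suc k)"
  proof -
    have "w i \<le> w (Suc k)" if "i \<in> ?A" for i
      using w[of "Suc k" i] that S(1) k1 by (cases "i = Suc k") auto
    then show ?thesis using sum_bounded_above[of ?A w "w (Suc k)"] by simp
  qed
  also have "\<dots> < card ?A * w k"
    using w[OF k0 k1] \<open>card ?A \<noteq> 0\<close> by simp
  also have "\<dots> \<le> sum w ?B"
  proof -
    have "w k \<le> w i" if "i \<in> ?B" for i
      using w[of i k] that k0 by (cases "i = k") auto
    then show ?thesis using sum_bounded_below[of ?B "w k" w] card by simp
  qed
  finally have "sum w ?A < sum w ?B" .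
  moreover have "sum w S = sum w (S \<inter> {1..k}) + sum w ?A"
    using fin by (metis sum.Int_Diff)
  moreover have "sum w {1..k} = sum w (S \<inter> {1..k}) + sum w ?B"
    by (metis Int_commute finite_atLeastAtMost sum.Int_Diff)
  ultimately show ?thesis by simp
qed

section \<open>Monic integer polynomials in one variable\<close>

definition monic_of_degree :: "int poly \<Rightarrow> nat \<Rightarrow> bool" where
  "monic_of_degree p d \<longleftrightarrow> degree p = d \<and> lead_coeff p = 1"

lemma monic_of_degree_mult:
  "monic_of_degree p d \<Longrightarrow> monic_of_degree q e \<Longrightarrow> monic_of_degree (p * q) (d + e)"
  unfolding monic_of_degree_def
  by (metis degree_mult_eq lead_coeff_mult leading_coeff_0_iff mult_1 zero_neq_one)

lemma monic_of_degree_power: "monic_of_degree p d \<Longrightarrow> monic_of_degree (p ^ k) (k * d)"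
  by (induction k) (auto simp: monic_of_degree_mult, simp add: monic_of_degree_def)

lemma monic_of_degree_prod:
  "(\<And>i. i \<in> I \<Longrightarrow> monic_of_degree (p i) (d i)) \<Longrightarrow> monic_of_degree (\<Prod>i\<in>I. p i) (\<Sum>i\<in>I. d i)"
  by (induction I rule: infinite_finite_induct)
     (auto simp: monic_of_degree_mult, simp_all add: monic_of_degree_def)

text \<open>A subset S contributes the monomial of degree \<open>sum w S\<close>, and {1..k} is the
  only k-subset of largest weight, so the top coefficient is exactly 1.\<close>

lemma monic_of_degree_elem_sym:
  assumes w: "\<And>i j. i \<in> {1..n} \<Longrightarrow> j \<in> {1..n} \<Longrightarrow> i < j \<Longrightarrow> w j < w i" and "k \<le> n"
  shows "monic_of_degree (elem_sym {1..n} (\<lambda>i. monom 1 (w i)) k) (sum w {1..k})"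
proof -
  let ?e = "elem_sym {1..n} (\<lambda>i. monom 1 (w i)) k :: int poly"
  let ?F = "{S. S \<subseteq> {1..n} \<and> card S = k}"
  have prod: "(\<Prod>i\<in>S. monom 1 (w i)) = (monom 1 (sum w S) :: int poly)" for S :: "nat set"
    by (induction S rule: infinite_finite_induct) (simp_all add: mult_monom)
  have coeff: "coeff ?e d = (\<Sum>S\<in>?F. if sum w S = d then 1 else 0)" for d
    by (simp add: elem_sym_def prod coeff_sum)
  have fin: "finite ?F" by simp
  have top: "sum w S = sum w {1..k} \<longleftrightarrow> S = {1..k}" if "S \<in> ?F" for S
    using sum_initial_segment_less[where w = w and n = n and S = S and k = k, OF w] that by (cases "S = {1..k}") auto
  have "coeff ?e (sum w {1..k}) = (\<Sum>S\<in>?F. if S = {1..k} then 1 else 0)"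
    unfolding coeff by (intro sum.cong refl) (simp only: top)
  also have "\<dots> = 1"
    using \<open>k \<le> n\<close> by (simp add: sum.delta[OF fin])
  finally have 1: "coeff ?e (sum w {1..k}) = 1" .
  have "coeff ?e d = 0" if "d > sum w {1..k}" for d
    unfolding coeff
  proof (intro sum.neutral ballI)
    fix S assume S: "S \<in> ?F"
    then have "sum w S \<le> sum w {1..k}"
      using sum_initial_segment_less[where w = w and n = n and S = S and k = k, OF w] by (cases "S = {1..k}") auto
    then show "(if sum w S = d then 1 else 0) = (0 :: int)"
      using that by simp
  qed
  then have "degree ?e \<le> sum w {1..k}"
    by (intro degree_le) simp
  then have "degree ?e = sum w {1..k}"
    using 1 le_degree[of ?e "sum w {1..k}"] by simp
  then show ?thesis using 1 by (simp add: monic_of_degree_def)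
qed

text \<open>
  Among the coefficients that \<open>c\<close> does not divide, the one whose monomial has the largest degree
  survives modulo \<open>c\<close> as the coefficient of the sum in that degree.
\<close>
lemma dvd_coeffs_of_distinct_degrees:
  fixes a :: "'m \<Rightarrow> int"
  assumes "finite K" "inj_on d K" "\<And>m. m \<in> K \<Longrightarrow> monic_of_degree (p m) (d m)"
    and dvd: "\<And>e. c dvd coeff (\<Sum>m\<in>K. of_int (a m) * p m) e" and "m \<in> K"
  shows "c dvd a m"
proof (rule ccontr)
  assume "\<not> c dvd a m"
  let ?B = "{m \<in> K. \<not> c dvd a m}"
  have "finite (d ` ?B)" "d ` ?B \<noteq> {}"
    using assms \<open>\<not> c dvd a m\<close> by auto
  then have "Max (d ` ?B) \<in> d ` ?B" by (rule Max_in)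
  then obtain t where t: "t \<in> ?B" "d t = Max (d ` ?B)" by (metis (no_types, lifting) imageE)
  have t_max: "d s \<le> d t" if "s \<in> ?B" for s
    using that assms(1) t(2) by auto
  have coeff: "coeff (\<Sum>m\<in>K. of_int (a m) * p m) e = (\<Sum>m\<in>K. a m * coeff (p m) e)" for e
    by (simp add: coeff_sum of_int_poly)
  have "c dvd a s * coeff (p s) (d t)" if "s \<in> K - {t}" for s
  proof (cases "c dvd a s")
    case False
    then have "d s < d t"
      using t_max[of s] that t(1) inj_onD[OF assms(2), of s t] by (cases "d s = d t") auto
    then have "coeff (p s) (d t) = 0"
      using assms(3)[of s] that by (auto simp: monic_of_degree_def intro: coeff_eq_0)
    then show ?thesis by simp
  qed simp
  then have "c dvd (\<Sum>s\<in>K - {t}. a s * coeff (p s) (d t))"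
    by (intro dvd_sum) auto
  moreover have "(\<Sum>s\<in>K. a s * coeff (p s) (d t))
      = a t * coeff (p t) (d t) + (\<Sum>s\<in>K - {t}. a s * coeff (p s) (d t))"
    using assms(1) t(1) by (intro sum.remove) auto
  moreover have "coeff (p t) (d t) = 1"
    using assms(3)[of t] t(1) by (auto simp: monic_of_degree_def)
  ultimately have "c dvd a t"
    using dvd[of "d t"] coeff by (simp add: dvd_add_left_iff)
  then show False using t(1) by simp
qed

text \<open>
  Substituting powers of one variable with exponents \<open>M\<^bsup>n-i\<^esup>\<close> for \<open>x\<^sub>i\<close> and \<open>M\<^bsup>2n-i\<^esup>\<close> for \<open>y\<^sub>i\<close>
  turns each \<open>e\<^sub>k\<close> into a monic polynomial of degree \<open>\<Sum>i\<le>k\<close> of the exponents, so a monomial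
  \<open>\<Prod> e\<^sub>k\<^bsup>\<mu> k\<^esup>\<close> has a degree whose base-\<open>M\<close> digits are the tail sums of \<open>\<mu>\<close>.
\<close>
lemma dvd_lookup_of_dvd_eval_elem_sym:
  fixes q :: "(nat + nat) zpoly"
  assumes vars: "zpoly_vars q \<subseteq> Inl ` {1..n} \<union> Inr ` {1..n}"
    and dvd: "zpoly_eval (case_sum (elem_sym {1..n} (\<lambda>i. zvar (Inl i)))
        (elem_sym {1..n} (\<lambda>j. zvar (Inr j)))) q = of_int c * (r :: (nat + nat) zpoly)"
  shows "c dvd Poly_Mapping.lookup q m"
proof (cases "m \<in> Poly_Mapping.keys q")
  case False
  then show ?thesis by (simp add: in_keys_iff)
next
  case mK: True
  let ?K = "Poly_Mapping.keys q"
  define V :: "(nat + nat) set" where "V = Inl ` {1..n} \<union> Inr ` {1..n}"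
  have V: "finite V" "\<And>m. m \<in> ?K \<Longrightarrow> Poly_Mapping.keys m \<subseteq> V"
    using vars by (auto simp: V_def zpoly_vars_def)
  \<comment> \<open>The digit at \<open>M ^ i\<close>: positions below \<open>n\<close> belong to
    the first block, with index \<open>n - i\<close>, the others to the second, with index
    \<open>2 * n - i\<close>.\<close>
  define tail where "tail m i = (if i < n then \<Sum>k=n - i..n. Poly_Mapping.lookup m (Inl k)
      else \<Sum>k=2 * n - i..n. Poly_Mapping.lookup m (Inr k))" for m :: "(nat + nat) \<Rightarrow>\<^sub>0 nat" and i
  \<comment> \<open>The double sum bounds every digit; the summand 2 ensures \<open>M > 1\<close>,
    so that the weights decrease strictly.\<close>
  define M where "M = 2 + (\<Sum>m\<in>?K. \<Sum>i<2 * n. tail m i)"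
  have tail_less: "tail m i < M" if "m \<in> ?K" "i < 2 * n" for m i
  proof -
    have "tail m i \<le> (\<Sum>i<2 * n. tail m i)"
      using that by (intro member_le_sum) auto
    also have "\<dots> \<le> (\<Sum>m\<in>?K. \<Sum>i<2 * n. tail m i)"
      using that by (intro member_le_sum) auto
    finally show ?thesis by (simp add: M_def)
  qed
  have M: "M > 1" by (simp add: M_def)
  define wx where "wx i = M ^ (n - i)" for i
  define wy where "wy i = M ^ (2 * n - i)" for i
  define D where "D = case_sum (\<lambda>k. sum wx {1..k}) (\<lambda>k. sum wy {1..k})"
  define deg where "deg m = (\<Sum>v\<in>V. Poly_Mapping.lookup m v * D v)" for m

  have swap: "(\<Sum>k=1..n. f k * (\<Sum>i=1..k. w i)) = (\<Sum>i=1..n. w i * (\<Sum>k=i..n. f k))"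
    for f w :: "nat \<Rightarrow> nat"
  proof -
    have "(\<Sum>k=1..n. f k * (\<Sum>i=1..k. w i)) = (\<Sum>k=1..n. \<Sum>i=1..k. f k * w i)"
      by (simp add: sum_distrib_left)
    also have "\<dots> = (\<Sum>i=1..n. \<Sum>k=i..n. f k * w i)"
      by (simp add: sum.Sigma)
         (rule sum.reindex_bij_witness[of _ "\<lambda>(i, k). (k, i)" "\<lambda>(i, k). (k, i)"], auto)
    finally show ?thesis by (simp add: sum_distrib_left mult.commute)
  qed
  have deg: "deg m = (\<Sum>i<2 * n. M ^ i * tail m i)" for m
  proof -
    have "deg m = (\<Sum>k=1..n. Poly_Mapping.lookup m (Inl k) * sum wx {1..k})
        + (\<Sum>k=1..n. Poly_Mapping.lookup m (Inr k) * sum wy {1..k})"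
      unfolding deg_def V_def
      by (subst sum.union_disjoint) (auto simp: sum.reindex D_def)
    also have "\<dots> = (\<Sum>i=1..n. wx i * (\<Sum>k=i..n. Poly_Mapping.lookup m (Inl k)))
        + (\<Sum>i=1..n. wy i * (\<Sum>k=i..n. Poly_Mapping.lookup m (Inr k)))"
      by (simp only: swap)
    also have "(\<Sum>i=1..n. wx i * (\<Sum>k=i..n. Poly_Mapping.lookup m (Inl k)))
        = (\<Sum>i\<in>{..<n}. M ^ i * tail m i)"
      by (rule sum.reindex_bij_witness[of _ "\<lambda>i. n - i" "\<lambda>i. n - i"])
         (auto simp: wx_def tail_def)
    also have "(\<Sum>i=1..n. wy i * (\<Sum>k=i..n. Poly_Mapping.lookup m (Inr k)))
        = (\<Sum>i\<in>{n..<2 * n}. M ^ i * tail m i)"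
      by (rule sum.reindex_bij_witness[of _ "\<lambda>i. 2 * n - i" "\<lambda>i. 2 * n - i"])
         (auto simp: wy_def tail_def)
    also have "(\<Sum>i\<in>{..<n}. M ^ i * tail m i) + (\<Sum>i\<in>{n..<2 * n}. M ^ i * tail m i)
        = (\<Sum>i<2 * n. M ^ i * tail m i)"
      by (subst sum.union_disjoint[symmetric]) (auto intro!: sum.cong)
    finally show ?thesis .
  qed
  have inj: "inj_on deg ?K"
  proof (rule inj_onI)
    fix m m' assume mm: "m \<in> ?K" "m' \<in> ?K" "deg m = deg m'"
    have eq: "tail m i = tail m' i" if "i < 2 * n" for i
      using digits_unique[of "2 * n" "tail m" M "tail m'" i] tail_less mm that by (simp add: deg)
    \<comment> \<open>An exponent is the difference of consecutive tail sums. The case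
      \<open>k = n\<close> is separate: there \<open>n - Suc k\<close> would truncate to 0 and
      \<open>2 * n - Suc k\<close> would fall into the first block.\<close>
    have lookup_tail: "Poly_Mapping.lookup p (Inl k) = tail p (n - k) - (if k = n then 0 else tail p (n - Suc k))"
      "Poly_Mapping.lookup p (Inr k) = tail p (2 * n - k) - (if k = n then 0 else tail p (2 * n - Suc k))"
      if "k \<in> {1..n}" for p k
      using that by (auto simp: tail_def sum.atLeast_Suc_atMost[of k n])
    show "m = m'"
    proof (rule poly_mapping_eqI)
      fix v
      show "Poly_Mapping.lookup m v = Poly_Mapping.lookup m' v"
      proof (cases "v \<in> V")
        case True
        then show ?thesis by (auto simp: V_def lookup_tail eq)
      next
        case False
        then show ?thesis using V(2)[OF mm(1)] V(2)[OF mm(2)] by (metis in_keys_iff subsetD)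
      qed
    qed
  qed
  define \<tau> :: "nat + nat \<Rightarrow> int poly" where
    "\<tau> = case_sum (\<lambda>i. monom 1 (wx i)) (\<lambda>i. monom 1 (wy i))"
  define E where "E = case_sum (elem_sym {1..n} (\<lambda>i. \<tau> (Inl i))) (elem_sym {1..n} (\<lambda>i. \<tau> (Inr i)))"
  have "wx j < wx i" "wy j < wy i" if "i \<in> {1..n}" "j \<in> {1..n}" "i < j" for i j
    using M that by (auto simp: wx_def wy_def intro!: power_strict_increasing)
  then have "monic_of_degree (E v) (D v)" if "v \<in> V" for v
    using that by (auto simp: V_def E_def D_def \<tau>_def simp del: One_nat_def intro!: monic_of_degree_elem_sym)
  then have monic: "monic_of_degree (monom_eval E m) (deg m)" if "m \<in> ?K" for m
    unfolding deg_def monom_eval_superset[OF V(1) V(2)[OF that]]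
    by (intro monic_of_degree_prod monic_of_degree_power)
  \<comment> \<open>Applying \<tau> to the assumed identity turns it into one between polynomials in
    a single variable, with the factor \<open>c\<close> preserved.\<close>
  have "(\<lambda>v. zpoly_eval \<tau> (case_sum (elem_sym {1..n} (\<lambda>i. zvar (Inl i)))
      (elem_sym {1..n} (\<lambda>j. zvar (Inr j))) v)) = E"
    by (rule ext) (simp add: E_def zpoly_eval_elem_sym split: sum.split)
  then have "zpoly_eval E q = of_int c * zpoly_eval \<tau> r"
    using arg_cong[OF dvd, of "zpoly_eval \<tau>"]
    by (simp only: zpoly_eval_zpoly_eval zpoly_eval_mult zpoly_eval_of_int)
  then have "c dvd coeff (\<Sum>m\<in>?K. of_int (Poly_Mapping.lookup q m) * monom_eval E m) e" for e
    by (simp add: zpoly_eval_superset[of ?K q] of_int_poly)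
  from dvd_coeffs_of_distinct_degrees[OF _ inj monic this mK] show ?thesis by simp
qed

section \<open>The structure polynomials\<close>

lemma fact_mult_ene_Q:
  "of_int ((- 1) ^ n * fact n) * ene_Q n
    = scaled_exp (\<lambda>k. - (log_deriv (\<lambda>i. zvar (Inl i)) k * log_deriv (\<lambda>i. zvar (Inr i)) k)) n"
proof -
  let ?V = "Inl ` {1..n} \<union> Inr ` {1..n} :: (nat + nat) set"
  let ?e = "case_sum (elem_sym {1..n} (\<lambda>i. zvar (Inl i))) (elem_sym {1..n} (\<lambda>j. zvar (Inr j)))
    :: nat + nat \<Rightarrow> (nat + nat) zpoly"
  let ?s = "elem_sym ({1..n} \<times> {1..n}) (\<lambda>(i, j). zvar (Inl i) * zvar (Inr j)) n :: (nat + nat) zpoly"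
  let ?c = "(- 1) ^ n * fact n :: int"
  define p where "p = scaled_exp
    (\<lambda>k. - (log_deriv (\<lambda>i. zvar (Inl i)) k * log_deriv (\<lambda>i. zvar (Inr i)) k) :: (nat + nat) zpoly) n"
  have vars: "zpoly_vars p \<subseteq> ?V"
    unfolding p_def
    by (intro zpoly_vars_scaled_exp zpoly_vars_uminus zpoly_vars_mult zpoly_vars_log_deriv)
       (auto simp: zpoly_vars_zvar)
  have "zpoly_eval ?e p = scaled_exp
      (\<lambda>k. - (log_deriv (elem_sym {1..n} (\<lambda>i. zvar (Inl i))) k
            * log_deriv (elem_sym {1..n} (\<lambda>j. zvar (Inr j))) k)) n"
    unfolding p_def
    by (simp only: zpoly_eval_scaled_exp zpoly_eval_uminus zpoly_eval_mult zpoly_eval_log_deriv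
        zpoly_eval_zvar sum.case)
  also have "\<dots> = of_int ?c * ?s"
    by (subst scaled_exp_products) simp_all
  finally have eval: "zpoly_eval ?e p = of_int ?c * ?s" .
  \<comment> \<open>Independence modulo (-1)^n n! makes every coefficient of \<open>p\<close>
    divisible; the quotient is the witness for \<open>ene_Q n\<close>.\<close>
  obtain q where q: "p = of_int ?c * q" "Poly_Mapping.keys q \<subseteq> Poly_Mapping.keys p"
    using ex_zpoly_quotient[of ?c p] dvd_lookup_of_dvd_eval_elem_sym[OF vars eval] by blast
  have "?s = zpoly_eval ?e q"
  proof (rule of_int_mult_cancel_zpoly)
    show "of_int ?c * ?s = of_int ?c * zpoly_eval ?e q"
      using eval unfolding q(1) zpoly_eval_mult zpoly_eval_of_int by (rule sym)
  qed simp
  moreover have "zpoly_vars q \<subseteq> ?V"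
    using vars q(2) by (auto simp: zpoly_vars_def)
  ultimately have "ene_Q n = q"
    unfolding ene_Q_def
  proof (intro the_equality conjI)
    fix q' assume s: "?s = zpoly_eval ?e q" and vq: "zpoly_vars q \<subseteq> ?V"
      and q': "zpoly_vars q' \<subseteq> ?V \<and> ?s = zpoly_eval ?e q'"
    \<comment> \<open>Independence with \<open>c = 0\<close>: divisibility by 0 means that all
      coefficients of the difference vanish.\<close>
    have "zpoly_eval ?e (q' - q) = of_int 0 * 0"
      using s q' by (simp add: zpoly_eval_diff)
    then have "0 dvd Poly_Mapping.lookup (q' - q) m" for m
      using q' vq by (intro dvd_lookup_of_dvd_eval_elem_sym zpoly_vars_diff) auto
    then show "q' = q"
      by (intro poly_mapping_eqI) (simp add: lookup_minus)
  qed
  then show ?thesis using q(1) p_def by simp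
qed

text \<open>The identity for \<open>ene_Q n\<close> is evaluated at the coefficients of
  \<open>f\<close> and \<open>g\<close>; the sign (-1)^n is the one in the definition of
  \<star>.\<close>

lemma fact_mult_ene_prod:
  fixes f g :: "'a::comm_ring_1 fps"
  shows "of_nat (fact n) * fps_nth (f \<star> g) n
    = scaled_exp (\<lambda>k. - (log_deriv (fps_nth f) k * log_deriv (fps_nth g) k)) n"
proof (cases "n = 0")
  case True
  then show ?thesis by (simp add: ene_prod_def)
next
  case False
  have "of_int (fact n) = (of_nat (fact n) :: 'a)"
    by (metis of_int_of_nat_eq of_nat_fact)
  then have "of_nat (fact n) * fps_nth (f \<star> g) n
      = zpoly_eval (case_sum (fps_nth f) (fps_nth g)) (of_int ((- 1) ^ n * fact n) * ene_Q n)"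
    using False by (simp add: ene_prod_def zpoly_eval_mult mult_ac del: of_int_mult)
      (simp add: mult_ac)
  also have "\<dots> = scaled_exp (\<lambda>k. - (log_deriv (fps_nth f) k * log_deriv (fps_nth g) k)) n"
    by (simp only: fact_mult_ene_Q zpoly_eval_scaled_exp zpoly_eval_uminus zpoly_eval_mult
        zpoly_eval_log_deriv zpoly_eval_zvar sum.case)
  finally show ?thesis .
qed

section \<open>The exponential of a power series\<close>

text \<open>Convergence is coefficientwise: coefficient \<open>k\<close> of the partial sums is
  constant once all terms with index up to \<open>k\<close> are included.\<close>

lemma suminf_fps:
  fixes u :: "nat \<Rightarrow> 'a::comm_ring_1 fps"
  assumes "\<And>n k. k < n \<Longrightarrow> fps_nth (u n) k = 0"
  shows "suminf u = Abs_fps (\<lambda>k. \<Sum>n\<le>k. fps_nth (u n) k)"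
proof (rule sums_unique[symmetric], unfold sums_def tendsto_fps_iff, intro allI)
  fix k
  have "fps_nth (\<Sum>n<N. u n) k = fps_nth (Abs_fps (\<lambda>k. \<Sum>n\<le>k. fps_nth (u n) k)) k" if "N > k" for N
    unfolding fps_sum_nth fps_nth_Abs_fps
    by (rule sum.mono_neutral_right) (use that assms in auto)
  then show "\<forall>\<^sub>F N in sequentially.
      fps_nth (\<Sum>n<N. u n) k = fps_nth (Abs_fps (\<lambda>k. \<Sum>n\<le>k. fps_nth (u n) k)) k"
    by (intro eventually_sequentiallyI[of "Suc k"]) auto
qed

lemma fps_nth_power_eq_0:
  fixes F :: "'a::comm_ring_1 fps"
  assumes "fps_nth F 0 = 0" "k < n"
  shows "fps_nth (F ^ n) k = 0"
  using startsby_zero_power_prefix[OF assms(1), of n] assms(2) by blast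

text \<open>Powers beyond \<open>k\<close> do not reach coefficient \<open>k\<close>. The free
  cut-off \<open>N\<close> lets several coefficients share one finite sum.\<close>

lemma fps_nth_Exp:
  assumes "fps_nth F 0 = 0" "k \<le> N"
  shows "fps_nth (fps_Exp \<iota> F) k = (\<Sum>n\<le>N. \<iota> (1 / fact n) * fps_nth (F ^ n) k)"
proof -
  have "fps_nth (fps_Exp \<iota> F) k = (\<Sum>n\<le>k. \<iota> (1 / fact n) * fps_nth (F ^ n) k)"
    unfolding fps_Exp_def by (subst suminf_fps) (simp_all add: fps_nth_power_eq_0[OF assms(1)])
  also have "\<dots> = (\<Sum>n\<le>N. \<iota> (1 / fact n) * fps_nth (F ^ n) k)"
    by (rule sum.mono_neutral_left) (use assms in \<open>auto simp: fps_nth_power_eq_0\<close>)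
  finally show ?thesis .
qed

lemma fps_nth_Exp_0:
  assumes "comm_ring_hom \<iota>" "fps_nth F 0 = 0"
  shows "fps_nth (fps_Exp \<iota> F) 0 = 1"
proof -
  interpret comm_ring_hom \<iota> by fact
  show ?thesis using fps_nth_Exp[OF assms(2), of 0 0] by (simp add: hom_one)
qed

text \<open>The coefficient form of (e^F)' = e^F F', by termwise differentiation: the derivative of
  F^(n+1)/(n+1)! is F^n/n! times F'.\<close>

lemma fps_nth_Exp_Suc:
  assumes "comm_ring_hom \<iota>" "fps_nth F 0 = 0"
  shows "of_nat (Suc k) * fps_nth (fps_Exp \<iota> F) (Suc k)
    = (\<Sum>i=0..k. fps_nth (fps_Exp \<iota> F) i * fps_nth (fps_deriv F) (k - i))"
proof -
  interpret comm_ring_hom \<iota> by fact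
  have fact: "\<iota> (1 / fact (Suc n)) * of_nat (Suc n) = \<iota> (1 / fact n)" for n
  proof -
    have "\<iota> (1 / fact (Suc n)) * of_nat (Suc n) = \<iota> (1 / fact (Suc n) * of_nat (Suc n))"
      by (simp only: hom_mult hom_of_nat)
    also have "1 / fact (Suc n) * of_nat (Suc n) = (1 / fact n :: rat)"
      by (simp add: field_simps del: of_nat_Suc)
    finally show ?thesis .
  qed
  have "of_nat (Suc k) * fps_nth (fps_Exp \<iota> F) (Suc k)
      = (\<Sum>n\<le>Suc k. \<iota> (1 / fact n) * fps_nth (fps_deriv (F ^ n)) k)"
    by (simp add: fps_nth_Exp[OF assms(2) order_refl] sum_distrib_left mult_ac
        del: of_nat_Suc sum.atMost_Suc)
  also have "\<dots> = (\<Sum>n\<le>k. \<iota> (1 / fact (Suc n)) * fps_nth (fps_deriv (F ^ Suc n)) k)"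
    by (subst sum.atMost_Suc_shift) simp
  also have "\<dots> = (\<Sum>n\<le>k. \<iota> (1 / fact n) * fps_nth (F ^ n * fps_deriv F) k)"
  proof (intro sum.cong refl)
    fix n
    have "fps_deriv (F ^ Suc n) = fps_const (of_nat (Suc n)) * (F ^ n * fps_deriv F)"
      by (subst fps_deriv_power') (simp add: fps_of_nat mult_ac del: of_nat_Suc power_Suc)
    then have "fps_nth (fps_deriv (F ^ Suc n)) k = of_nat (Suc n) * fps_nth (F ^ n * fps_deriv F) k"
      by (simp only: fps_mult_left_const_nth)
    then show "\<iota> (1 / fact (Suc n)) * fps_nth (fps_deriv (F ^ Suc n)) k
        = \<iota> (1 / fact n) * fps_nth (F ^ n * fps_deriv F) k"
      by (simp only: fact mult.assoc[symmetric])
  qed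
  also have "\<dots> = (\<Sum>n\<le>k. \<Sum>i=0..k. \<iota> (1 / fact n) * fps_nth (F ^ n) i * fps_nth (fps_deriv F) (k - i))"
    by (simp only: fps_mult_nth sum_distrib_left mult.assoc)
  \<comment> \<open>The inner sum keeps the cut-off \<open>k\<close> for every \<open>i\<close>,
    which still gives coefficient \<open>i\<close> of the exponential because
    \<open>i \<le> k\<close>.\<close>
  also have "\<dots> = (\<Sum>i=0..k. (\<Sum>n\<le>k. \<iota> (1 / fact n) * fps_nth (F ^ n) i) * fps_nth (fps_deriv F) (k - i))"
    by (subst sum.swap) (simp only: sum_distrib_right)
  also have "\<dots> = (\<Sum>i=0..k. fps_nth (fps_Exp \<iota> F) i * fps_nth (fps_deriv F) (k - i))"
    by (intro sum.cong refl) (simp add: fps_nth_Exp[OF assms(2), of _ k])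
  finally show ?thesis .
qed

lemma log_deriv_Exp:
  assumes "comm_ring_hom \<iota>" "fps_nth F 0 = 0"
  shows "log_deriv (fps_nth (fps_Exp \<iota> F)) k = fps_nth (fps_deriv F) k"
  by (rule log_deriv_unique) (simp_all only: fps_nth_Exp_0[OF assms] fps_nth_Exp_Suc[OF assms])

lemma scaled_exp_deriv:
  assumes "comm_ring_hom \<iota>" "fps_nth F 0 = 0"
  shows "scaled_exp (fps_nth (fps_deriv F)) n = of_nat (fact n) * fps_nth (fps_Exp \<iota> F) n"
  by (rule scaled_exp_unique) (simp_all only: fps_nth_Exp_0[OF assms] fps_nth_Exp_Suc[OF assms])

text \<open>The image of 1/n! under \<iota> is an inverse of n!.\<close>

lemma of_nat_fact_cancel:
  fixes \<iota> :: "rat \<Rightarrow> 'a::comm_ring_1"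
  assumes "comm_ring_hom \<iota>" "of_nat (fact n) * a = of_nat (fact n) * (b :: 'a)"
  shows "a = b"
proof -
  interpret comm_ring_hom \<iota> by fact
  have "\<iota> (1 / fact n) * of_nat (fact n) = \<iota> (1 / fact n * of_nat (fact n))"
    by (simp only: hom_mult hom_of_nat)
  then have inv: "\<iota> (1 / fact n) * of_nat (fact n) = 1"
    by (simp add: hom_one)
  have "a = \<iota> (1 / fact n) * (of_nat (fact n) * a)"
    by (simp only: mult.assoc[symmetric] inv mult_1)
  also have "\<dots> = b"
    by (simp only: assms(2) mult.assoc[symmetric] inv mult_1)
  finally show ?thesis .
qed

theorem theorem4p1:
  fixes \<iota> :: "rat \<Rightarrow> 'a::comm_ring_1"
    and f g F G :: "'a fps"
  assumes "inj_comm_ring_hom \<iota>"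
    and "fps_nth f 0 = 1" and "fps_nth g 0 = 1"
    and "fps_nth F 0 = 0" and "fps_nth G 0 = 0"
    and "f = fps_Exp \<iota> F" and "g = fps_Exp \<iota> G"
  shows "f \<star> g =
    fps_Exp \<iota> (- suminf (\<lambda>i. fps_const (of_nat (Suc i) * fps_nth F (Suc i) * fps_nth G (Suc i)) * fps_X ^ Suc i))"
proof (rule fps_ext)
  fix n
  let ?H = "- suminf (\<lambda>i. fps_const (of_nat (Suc i) * fps_nth F (Suc i) * fps_nth G (Suc i)) * fps_X ^ Suc i)"
  have hom: "comm_ring_hom \<iota>"
    using assms(1) by (simp add: inj_comm_ring_hom_def)
  have H: "fps_nth ?H k = - (of_nat k * fps_nth F k * fps_nth G k)" for k
  proof (cases k)
    case 0
    then show ?thesis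
      by (subst suminf_fps) (simp_all del: power_Suc)
  next
    case (Suc j)
    then show ?thesis
      by (subst suminf_fps) (simp_all add: if_distrib sum.delta del: power_Suc of_nat_Suc cong: if_cong)
  qed
  then have H0: "fps_nth ?H 0 = 0" by simp
  \<comment> \<open>Both sides are -(k+1)^2 F_(k+1) G_(k+1): one factor k+1 is the weight in the sum
    and the other comes from differentiation, while on the right F' and G' supply one each.\<close>
  have "fps_nth (fps_deriv ?H) k = - (log_deriv (fps_nth f) k * log_deriv (fps_nth g) k)" for k
    unfolding assms(6,7) log_deriv_Exp[OF hom assms(4)] log_deriv_Exp[OF hom assms(5)]
      fps_deriv_nth H
    by (simp add: mult_ac del: of_nat_Suc of_nat_add)
  then have "fps_nth (fps_deriv ?H) = (\<lambda>k. - (log_deriv (fps_nth f) k * log_deriv (fps_nth g) k))" by blast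
  \<comment> \<open>Both sides are now \<open>scaled_exp\<close> of the same sequence.\<close>
  then have "of_nat (fact n) * fps_nth (f \<star> g) n = of_nat (fact n) * fps_nth (fps_Exp \<iota> ?H) n"
    by (simp only: fact_mult_ene_prod scaled_exp_deriv[OF hom H0, symmetric])
  then show "fps_nth (f \<star> g) n = fps_nth (fps_Exp \<iota> ?H) n"
    by (rule of_nat_fact_cancel[OF hom])
qed

end
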